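(* Let $\mathcal{R}$ be a commutative ring with unity such that $\frac12\in\mathcal{R}$, let $a,b\in\mathcal{R}$ be units, and let $\mathcal{H}^{a,b}$ be the generalized quaternion algebra over $\mathcal{R}$, regarded as a superalgebra. Then every local superderivation of degree $0$ on $\mathcal{H}^{a,b}$ is a superderivation of degree $0$ of $\mathcal{H}^{a,b}$.
   Context: The generalized quaternion algebra $\mathcal{H}^{a,b}$ is the free $\mathcal{R}$-module with basis $\{1,i,j,k\}$ with the associative unital ($\mathcal{R}$-bilinear) multiplication determined by $i^2=-a$, $j^2=-b$, $k^2=-ab$, $ij=-ji=k$, $jk=-kj=bi$, $ki=-ik=aj$. It is a superalgebra ($\mathbb{Z}_2$-graded algebra) with even part $\mathcal{A}_0=\mathcal{R}\oplus\mathcal{R}i$ and odd part $\mathcal{A}_1=\mathcal{R}j\oplus\mathcal{R}k$; for $x\in\mathcal{A}_\alpha$ write $|x|=\alpha$. For $\alpha\in\{0,1\}$, a superderivation of degree $\alpha$ of $\mathcal{A}=\mathcal{H}^{a,b}$ is an $\mathcal{R}$-linear map $D:\mathcal{A}\to\mathcal{A}$ with $D(\mathcal{A}_\beta)\subseteq\mathcal{A}_{\alpha+\beta}$ (indices mod 2) and $D(xy)=D(x)y+(-1)^{\alpha|x|}xD(y)$ for all $x,y\in\mathcal{A}_0\cup\mathcal{A}_1$. A local superderivation of degree $\gamma\in\mathbb{Z}_2$ is an $\mathcal{R}$-linear map $\Delta:\mathcal{H}^{a,b}\to\mathcal{H}^{a,b}$ such that for every $x\in\mathcal{H}^{a,b}$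 there exists a superderivation $d_x$ of degree $\gamma$ of $\mathcal{H}^{a,b}$ (depending on $x$) with $\Delta(x)=d_x(x)$. *)

theory Defs
  imports Main
begin

text \<open>
  The coefficient ring is a type of sort \<open>{comm_ring, comm_monoid_mult}\<close>: a commutative ring with
  unity. Compared with \<open>comm_ring_1\<close> this only drops \<open>0 \<noteq> 1\<close>, so the zero ring is included.

  The underlying free module of the quaternion algebra does not depend on the structure constants
  \<open>a\<close> and \<open>b\<close>; they are parameters of the multiplication \<open>qmult a b\<close>.
\<close>

datatype 'r quat = Quat (c1: 'r) (ci: 'r) (cj: 'r) (ck: 'r)

instantiation quat :: (ab_group_add) ab_group_add
begin

definition "0 = Quat 0 0 0 0"
definition "x + y = Quat (c1 x + c1 y) (ci x + ci y) (cj x + cj y) (ck x + ck y)"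
definition "- x = Quat (- c1 x) (- ci x) (- cj x) (- ck x)"
definition "x - y = Quat (c1 x - c1 y) (ci x - ci y) (cj x - cj y) (ck x - ck y)"

instance
  by standard
    (simp_all add: zero_quat_def plus_quat_def uminus_quat_def minus_quat_def add.assoc add.commute)

end

definition qscale :: "'r::comm_ring \<Rightarrow> 'r quat \<Rightarrow> 'r quat" (infixr "*\<^sub>Q" 75)
  where "r *\<^sub>Q x = Quat (r * c1 x) (r * ci x) (r * cj x) (r * ck x)"

definition q1 :: "'r::{comm_ring, comm_monoid_mult} quat" where "q1 = Quat 1 0 0 0"
definition qi :: "'r::{comm_ring, comm_monoid_mult} quat" where "qi = Quat 0 1 0 0"
definition qj :: "'r::{comm_ring, comm_monoid_mult} quat" where "qj = Quat 0 0 1 0"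
definition qk :: "'r::{comm_ring, comm_monoid_mult} quat" where "qk = Quat 0 0 0 1"

text \<open>
  The bilinear extension of the multiplication table of the basis, which is recovered in
  \<open>qmult_table\<close> below.
\<close>

definition qmult :: "'r::comm_ring \<Rightarrow> 'r \<Rightarrow> 'r quat \<Rightarrow> 'r quat \<Rightarrow> 'r quat"
  where "qmult a b x y = Quat
    (c1 x * c1 y - a * (ci x * ci y) - b * (cj x * cj y) - a * b * (ck x * ck y))
    (c1 x * ci y + ci x * c1 y + b * (cj x * ck y - ck x * cj y))
    (c1 x * cj y + cj x * c1 y + a * (ck x * ci y - ci x * ck y))
    (c1 x * ck y + ck x * c1 y + (ci x * cj y - cj x * ci y))"

lemmas quat_defs = zero_quat_def plus_quat_def uminus_quat_def minus_quat_def
  qscale_def q1_def qi_def qj_def qk_def qmult_def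

lemma quat_basis:
  fixes x :: "'r::{comm_ring, comm_monoid_mult} quat"
  shows "\<exists>!(r, s, t, u). x = r *\<^sub>Q q1 + s *\<^sub>Q qi + t *\<^sub>Q qj + u *\<^sub>Q qk"
  by (cases x) (auto simp: quat_defs)

lemma qmult_table:
  fixes a b :: "'r::{comm_ring, comm_monoid_mult}"
  shows "qmult a b qi qi = - (a *\<^sub>Q q1)"
    and "qmult a b qj qj = - (b *\<^sub>Q q1)"
    and "qmult a b qk qk = - ((a * b) *\<^sub>Q q1)"
    and "qmult a b qi qj = qk" "qmult a b qj qi = - qk"
    and "qmult a b qj qk = b *\<^sub>Q qi" "qmult a b qk qj = - (b *\<^sub>Q qi)"
    and "qmult a b qk qi = a *\<^sub>Q qj" "qmult a b qi qk = - (a *\<^sub>Q qj)"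
  by (simp_all add: quat_defs)

lemma qmult_unital:
  fixes a b :: "'r::{comm_ring, comm_monoid_mult}"
  shows "qmult a b q1 x = x" "qmult a b x q1 = x"
  by (simp_all add: quat_defs)

lemma qmult_bilinear:
  "qmult a b (x + y) z = qmult a b x z + qmult a b y z"
  "qmult a b x (y + z) = qmult a b x y + qmult a b x z"
  "qmult a b (r *\<^sub>Q x) y = r *\<^sub>Q qmult a b x y"
  "qmult a b x (r *\<^sub>Q y) = r *\<^sub>Q qmult a b x y"
  by (simp_all add: quat_defs algebra_simps)

lemma qmult_assoc: "qmult a b (qmult a b x y) z = qmult a b x (qmult a b y z)"
  by (simp add: quat_defs algebra_simps)

text \<open>The grading; the index is read modulo 2.\<close>

definition qpart :: "nat \<Rightarrow> 'r::{comm_ring, comm_monoid_mult} quat set"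
  where "qpart \<beta> = (if even \<beta> then {r *\<^sub>Q q1 + s *\<^sub>Q qi | r s. True}
                              else {r *\<^sub>Q qj + s *\<^sub>Q qk | r s. True})"

text \<open>
  The library's \<open>module_hom\<close> needs coefficients in \<open>comm_ring_1\<close>, hence the explicit definition.
\<close>

definition qlinear :: "('r::comm_ring quat \<Rightarrow> 'r quat) \<Rightarrow> bool"
  where "qlinear D \<longleftrightarrow> (\<forall>x y. D (x + y) = D x + D y) \<and> (\<forall>r x. D (r *\<^sub>Q x) = r *\<^sub>Q D x)"

definition superderivation ::
  "'r::{comm_ring, comm_monoid_mult} \<Rightarrow> 'r \<Rightarrow> nat \<Rightarrow> ('r quat \<Rightarrow> 'r quat) \<Rightarrow> bool"
  where "superderivation a b \<alpha> D \<longleftrightarrow>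
    qlinear D \<and>
    (\<forall>\<beta>\<in>{0, 1}. D ` qpart \<beta> \<subseteq> qpart (\<alpha> + \<beta>)) \<and>
    (\<forall>\<beta>\<in>{0, 1}. \<forall>x\<in>qpart \<beta>. \<forall>y\<in>qpart 0 \<union> qpart 1.
       D (qmult a b x y) = qmult a b (D x) y + (- 1) ^ (\<alpha> * \<beta>) *\<^sub>Q qmult a b x (D y))"

definition local_superderivation ::
  "'r::{comm_ring, comm_monoid_mult} \<Rightarrow> 'r \<Rightarrow> nat \<Rightarrow> ('r quat \<Rightarrow> 'r quat) \<Rightarrow> bool"
  where "local_superderivation a b \<gamma> \<Delta> \<longleftrightarrow>
    qlinear \<Delta> \<and> (\<forall>x. \<exists>d. superderivation a b \<gamma> d \<and> \<Delta> x = d x)"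

end

theory Submission
  imports Defs
begin

text \<open>
  A superderivation of degree 0 kills 1 and i (square them and use that 2 and \<open>a\<close> are units), and
  sends j to a multiple \<open>t\<close> of k (square j); then k = ij goes to \<open>- a t\<close> times j. So the
  superderivations of degree 0 are a one-parameter family. A local superderivation agrees with
  members of this family at 1, i, j and k, and its value at j + k forces the two parameters
  found at j and at k to coincide.
\<close>

lemma double_eq_zero_imp:
  fixes x :: "'r::{comm_ring, comm_monoid_mult}"
  assumes "(1 + 1 :: 'r) dvd 1" and "x + x = 0"
  shows "x = 0"
proof -
  obtain h :: 'r where h: "1 = (1 + 1) * h"
    using assms(1) by (auto elim: dvdE)
  have "x = 1 * x" by simp
  also have "\<dots> = (x + x) * h"
    by (subst h) (simp add: algebra_simps)
  finally show ?thesis using assms(2) by simp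
qed

lemma unit_mult_left_cancel:
  fixes a x y :: "'r::{comm_ring, comm_monoid_mult}"
  assumes "a dvd 1" and "a * x = a * y"
  shows "x = y"
proof -
  obtain h where h: "1 = a * h"
    using assms(1) by (auto elim: dvdE)
  have "x = h * (a * x)" by (metis h mult.commute mult.assoc mult_1)
  also have "\<dots> = h * (a * y)" using assms(2) by simp
  also have "\<dots> = y" by (metis h mult.commute mult.assoc mult_1)
  finally show ?thesis .
qed

lemma qpart_even_iff: "even \<beta> \<Longrightarrow> x \<in> qpart \<beta> \<longleftrightarrow> cj x = 0 \<and> ck x = 0"
  by (cases x) (auto simp: qpart_def quat_defs)

lemma qpart_odd_iff: "odd \<beta> \<Longrightarrow> x \<in> qpart \<beta> \<longleftrightarrow> c1 x = 0 \<and> ci x = 0"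
  by (cases x) (auto simp: qpart_def quat_defs)

text \<open>Reduces equality of two maps to their values on the basis; it serves first for a
  superderivation and finally for the local one.\<close>

lemma qlinear_expand:
  fixes D :: "'r::{comm_ring, comm_monoid_mult} quat \<Rightarrow> 'r quat"
  assumes "qlinear D"
  shows "D x = c1 x *\<^sub>Q D q1 + ci x *\<^sub>Q D qi + cj x *\<^sub>Q D qj + ck x *\<^sub>Q D qk"
proof -
  have "x = c1 x *\<^sub>Q q1 + ci x *\<^sub>Q qi + cj x *\<^sub>Q qj + ck x *\<^sub>Q qk"
    by (cases x) (simp add: quat_defs)
  then have "D x = D (c1 x *\<^sub>Q q1 + ci x *\<^sub>Q qi + cj x *\<^sub>Q qj + ck x *\<^sub>Q qk)"
    by (rule arg_cong)
  with assms show ?thesis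
    by (simp add: qlinear_def)
qed

text \<open>Twice this map is \<open>t\<close> times the commutator with i, since ij - ji = 2k and
  ik - ki = - 2aj. With 1/2 at hand it is thus an inner derivation.\<close>

definition even_sd ::
  "'r::{comm_ring, comm_monoid_mult} \<Rightarrow> 'r \<Rightarrow> 'r quat \<Rightarrow> 'r quat"
  where "even_sd a t x = Quat 0 0 (- (a * (t * ck x))) (t * cj x)"

lemma superderivation_even_sd: "superderivation a b 0 (even_sd a t)"
  unfolding superderivation_def
  by (auto simp: qpart_even_iff qpart_odd_iff even_sd_def qlinear_def quat_defs algebra_simps)

text \<open>The Leibniz rule is needed at four products only: 1 * 1, i * i, j * j and i * j.\<close>

lemma superderivation_0_imp_even_sd:
  fixes a b :: "'r::{comm_ring, comm_monoid_mult}"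
  assumes half: "(1 + 1 :: 'r) dvd 1" and a: "a dvd 1" and b: "b dvd 1"
    and D: "superderivation a b 0 D"
  shows "\<exists>t. D = even_sd a t"
proof -
  have lin: "qlinear D"
    and even: "\<And>x. x \<in> qpart 0 \<Longrightarrow> D x \<in> qpart 0"
    and odd: "\<And>x. x \<in> qpart 1 \<Longrightarrow> D x \<in> qpart 1"
    and leibniz: "\<And>x y. x \<in> qpart 0 \<union> qpart 1 \<Longrightarrow> y \<in> qpart 0 \<union> qpart 1 \<Longrightarrow>
      D (qmult a b x y) = qmult a b (D x) y + qmult a b x (D y)"
    \<comment> \<open>In degree 0 the sign is \<open>(- 1) ^ 0 = 1\<close>, so the graded rule
      becomes the ordinary Leibniz rule on homogeneous elements.\<close>
    using D unfolding superderivation_def by (auto simp: qscale_def quat.expand)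
  note part = qpart_even_iff qpart_odd_iff
  have mem: "q1 \<in> qpart 0" "qi \<in> qpart 0" "qj \<in> qpart 1"
    by (simp_all add: part q1_def qi_def qj_def)
  have hom: "q1 \<in> qpart 0 \<union> qpart 1" "qi \<in> qpart 0 \<union> qpart 1" "qj \<in> qpart 0 \<union> qpart 1"
    using mem by blast+
  have scale: "D (r *\<^sub>Q x) = r *\<^sub>Q D x" for r x
    using lin by (simp add: qlinear_def)
  have D1: "D q1 = 0"
    using leibniz[OF hom(1) hom(1)] by (simp add: qmult_unital)
  \<comment> \<open>The squares of i and j have this form, so the left side of their Leibniz rules
    vanishes.\<close>
  have neg1: "D (- (r *\<^sub>Q q1)) = 0" for r
    using scale[of "- r" q1] D1 by (simp add: quat_defs)
  have Di: "D qi = 0"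
  proof -
    obtain p q where pq: "D qi = Quat p q 0 0"
      using even[OF mem(2)] by (cases "D qi") (auto simp: part)
    have "qmult a b (D qi) qi + qmult a b qi (D qi) = 0"
      using leibniz[OF hom(2) hom(2)] by (simp add: qmult_table neg1)
    \<comment> \<open>The even part is commutative, so the sum is 2(p + qi)i = - 2aq + 2pi.\<close>
    then have "p + p = 0" and "a * (q + q) = a * 0"
      unfolding pq by (simp_all add: quat_defs algebra_simps neg_eq_iff_add_eq_0)
    then show ?thesis
      using double_eq_zero_imp[OF half] unit_mult_left_cancel[OF a]
      by (metis pq zero_quat_def)
  qed
  obtain s t where st: "D qj = Quat 0 0 s t"
    using odd[OF mem(3)] by (cases "D qj") (auto simp: part)
  have "qmult a b (D qj) qj + qmult a b qj (D qj) = 0"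
    using leibniz[OF hom(3) hom(3)] by (simp add: qmult_table neg1)
  \<comment> \<open>As j and k anticommute, the \<open>t\<close> terms cancel and - 2bs remains;
    \<open>t\<close> stays free.\<close>
  then have "b * (s + s) = b * 0"
    unfolding st by (simp add: quat_defs algebra_simps neg_eq_iff_add_eq_0)
  then have s: "s = 0"
    using double_eq_zero_imp[OF half] unit_mult_left_cancel[OF b] by metis
  have Dk: "D qk = qmult a b qi (D qj)"
    using leibniz[OF hom(2) hom(3)] by (simp add: qmult_table Di) (simp add: quat_defs)
  have "D x = even_sd a t x" for x
    unfolding qlinear_expand[OF lin, of x] D1 Di Dk st s
    by (simp add: even_sd_def quat_defs algebra_simps)
  then show ?thesis by blast
qed

theorem theorem3p1:
  fixes a b :: "'r::{comm_ring, comm_monoid_mult}"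
    and \<Delta> :: "'r quat \<Rightarrow> 'r quat"
  assumes half: "(1 + 1 :: 'r) dvd 1"
    and a_unit: "a dvd 1"
    and b_unit: "b dvd 1"
    and local_sd: "local_superderivation a b 0 \<Delta>"
  shows "superderivation a b 0 \<Delta>"
proof -
  have lin: "qlinear \<Delta>"
    using local_sd by (simp add: local_superderivation_def)
  have ex: "\<exists>t. \<Delta> x = even_sd a t x" for x
    using local_sd superderivation_0_imp_even_sd[OF half a_unit b_unit]
    unfolding local_superderivation_def by metis
  have D1: "\<Delta> q1 = 0" and Di: "\<Delta> qi = 0"
    using ex[of q1] ex[of qi] by (auto simp: even_sd_def quat_defs)
  obtain t where Dj: "\<Delta> qj = Quat 0 0 0 t"
    using ex[of qj] by (auto simp: even_sd_def quat_defs)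
  obtain u where Dk: "\<Delta> qk = Quat 0 0 (- (a * u)) 0"
    using ex[of qk] by (auto simp: even_sd_def quat_defs)
  \<comment> \<open>By linearity the left side is - auj + tk, while the right side is - awj +
    wk.\<close>
  obtain w where "\<Delta> (qj + qk) = even_sd a w (qj + qk)"
    using ex by blast
  then have "t = w" and "a * u = a * w"
    using lin by (simp_all add: qlinear_def Dj Dk even_sd_def) (simp_all add: quat_defs)
  then have u: "u = t"
    using unit_mult_left_cancel[OF a_unit] by metis
  have "\<Delta> x = even_sd a t x" for x
    unfolding qlinear_expand[OF lin, of x] D1 Di Dj Dk u
    by (simp add: even_sd_def quat_defs algebra_simps)
  then have "\<Delta> = even_sd a t" by blast
  then show ?thesis by (simp add: superderivation_even_sd)
qed

end
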